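(* For infinitely many $\mathbf{a} \in \mathbb{Z}^n$ we have $$\ell(\mathbf{a}) \gg \left(\frac{\log \mathfrak{H}(\mathbf{a})}{\log\log \mathfrak{H}(\mathbf{a})}\right)^{1/n},$$ where the implied constant may depend on $n$.
   Context: For $\mathbf{x} \in \mathbb{Z}^n$, the height is $\mathfrak{H}(\mathbf{x}) = \max\{|x_1|,\ldots,|x_n|\}$. For $\mathbf{a} = (a_1,\ldots,a_n) \in \mathbb{Z}^n$, $\ell(\mathbf{a})$ denotes the smallest $H$ such that there is a vector $\mathbf{h} = (h_1,\ldots,h_n) \in \mathbb{Z}^n$ with $\mathfrak{H}(\mathbf{h}) = H$ and $\gcd(a_1+h_1,\ldots,a_n+h_n) = 1$. The notation $U \gg V$ means $|V| \le c\,U$ for some constant $c>0$. *)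

theory Defs
  imports "HOL-Analysis.Analysis"
begin

definition height :: "int ^ 'n \<Rightarrow> int" where
  "height x = Max (range (\<lambda>i. \<bar>x $ i\<bar>))"

definition ell :: "int ^ 'n \<Rightarrow> nat" where
  "ell a = (LEAST H. \<exists>h :: int ^ 'n. height h = int H \<and> Gcd (range (\<lambda>i. a $ i + h $ i)) = 1)"

lemma height_nonneg: "0 \<le> height (x :: int ^ 'n)"
proof -
  have "\<bar>x $ undefined\<bar> \<le> height x"
    unfolding height_def by (intro Max_ge) auto
  then show ?thesis by linarith
qed

text \<open>The set whose least element is \<open>ell a\<close> is nonempty, so the minimum is attained.\<close>

lemma ell_attained:
  fixes a :: "int ^ 'n"
  shows "\<exists>h :: int ^ 'n. height h = int (ell a) \<and> Gcd (range (\<lambda>i. a $ i + h $ i)) = 1"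
  unfolding ell_def
proof (rule LeastI_ex)
  define h :: "int ^ 'n" where "h = (\<chi> i. 1 - a $ i)"
  have "height h = int (nat (height h))"
    by (simp add: height_nonneg)
  moreover have "Gcd (range (\<lambda>i. a $ i + h $ i)) = 1"
    by (simp add: h_def)
  ultimately show "\<exists>H. \<exists>h :: int ^ 'n. height h = int H \<and> Gcd (range (\<lambda>i. a $ i + h $ i)) = 1"
    by blast
qed

end

theory Submission
  imports Defs "HOL-Number_Theory.Number_Theory"
begin

text \<open>
  Let \<open>N = (2H + 1)\<^sup>n\<close> be the number of vectors \<open>h\<close> of height at most \<open>H\<close>, and give each of them
  its own prime \<open>p\<^sub>h\<close>. The Chinese remainder theorem yields \<open>a\<close> with \<open>i\<close>-th coordinate
  congruent to \<open>- h\<^sub>i\<close> modulo \<open>p\<^sub>h\<close> for all \<open>h\<close> and \<open>i\<close>; then \<open>p\<^sub>h\<close> divides every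
  coordinate of \<open>a + h\<close>, so \<open>ell a > H\<close>. A Chebyshev bound provides \<open>N\<close> primes up to
  \<open>8 N\<^sup>2 + 1\<close>, whence \<open>ln (height a) = O(N ln N)\<close> and \<open>ln (height a) / ln (ln (height a)) = O(N)\<close>.
\<close>

subsection \<open>A lower bound for the number of primes\<close>

text \<open>
  This is the identity \<open>1 / ((m+2) C(m+1,k+1)) = 1 / ((m+1) C(m,k)) - 1 / ((m+2) C(m+1,k))\<close>
  of Leibniz' harmonic triangle, multiplied by the common multiple \<open>M\<close>.
\<close>
lemma Suc_times_binomial_dvd_common_multiple:
  fixes M :: nat
  assumes "k \<le> n" and "\<And>m. 1 \<le> m \<Longrightarrow> m \<le> Suc n \<Longrightarrow> m dvd M"
  shows "Suc n * (n choose k) dvd M"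
  using assms
proof (induction k arbitrary: n)
  case 0
  then show ?case by simp
next
  case (Suc k)
  then obtain m where n: "n = Suc m" and "k \<le> m"
    by (cases n) auto
  have "Suc m * (m choose k) dvd M"
    using Suc.IH[of m] Suc.prems n \<open>k \<le> m\<close> by simp
  then obtain u where u: "M = Suc m * (m choose k) * u" ..
  have "Suc (Suc m) * (Suc m choose k) dvd M"
    using Suc.IH[of "Suc m"] Suc.prems n \<open>k \<le> m\<close> by simp
  then obtain v where v: "M = Suc (Suc m) * (Suc m choose k) * v" ..
  \<comment> \<open>The identity of the harmonic triangle says that \<open>M\<close> divided by
    \<open>(m + 2) * A\<close> is \<open>u - v\<close>. Integers replace naturals because of this
    difference.\<close>
  define A B C where "A = int (Suc m choose Suc k)" and "B = int (Suc m * (m choose k))"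
    and "C = int (Suc m choose k)"
  have A: "A * (int k + 1) = B"
    using Suc_times_binomial_eq[of m k] unfolding A_def B_def
    by (metis of_nat_Suc of_nat_mult add.commute)
  have "Suc k * (Suc m choose Suc k) = (Suc m - k) * (Suc m choose k)"
    using binomial_absorb_comp[of "Suc m" k] Suc_times_binomial_eq[of m k] \<open>k \<le> m\<close>
    by (simp add: mult.commute)
  then have "int (Suc k) * A = int (Suc m - k) * C"
    unfolding A_def C_def by (metis of_nat_mult)
  then have C: "C * (int m + 1 - int k) = B"
    using A \<open>k \<le> m\<close> by (simp add: algebra_simps)
  have Mu: "int M = B * int u"
    using u unfolding B_def by (metis of_nat_mult)
  have Mv: "int M = (int m + 2) * C * int v"
    using arg_cong[OF v, of int] unfolding C_def of_nat_mult by simp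
  \<comment> \<open>Clearing denominators leaves a factor \<open>k + 1\<close>, the difference of
    \<open>m + 2\<close> and \<open>m + 1 - k\<close>; it is cancelled afterwards.\<close>
  have "(int k + 1) * ((int m + 2) * A * (int u - int v))
      = (int m + 2) * (A * (int k + 1) * int u) - (int m + 2) * (A * (int k + 1)) * int v"
    by (simp add: algebra_simps)
  also have "\<dots> = (int m + 2) * (B * int u) - (int m + 2) * (C * (int m + 1 - int k)) * int v"
    unfolding A C ..
  also have "\<dots> = (int m + 2) * (B * int u) - (int m + 1 - int k) * ((int m + 2) * C * int v)"
    by (simp add: algebra_simps)
  also have "\<dots> = (int k + 1) * int M"
    unfolding Mu[symmetric] Mv[symmetric] by (simp add: algebra_simps)
  finally have "int M = (int m + 2) * A * (int u - int v)"
    by (subst (asm) mult_cancel_left) auto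
  moreover have "int (Suc n * (n choose Suc k)) = (int m + 2) * A"
    unfolding n A_def of_nat_mult by simp
  ultimately have "int (Suc n * (n choose Suc k)) dvd int M"
    by (metis dvd_triv_left)
  then show ?case
    by (simp only: of_nat_dvd_iff)
qed

text \<open>The witness is the least common multiple of 1, ..., \<open>n\<close>: the product, over
  the primes up to \<open>n\<close>, of the largest power of each that is at most \<open>n\<close>.
  Every factor is at most \<open>n\<close>.\<close>

lemma ex_common_multiple_le_power_card_primes:
  fixes n :: nat
  assumes "n \<ge> 1"
  shows "\<exists>M. 0 < M \<and> M \<le> n ^ card {p. prime p \<and> p \<le> n} \<and> (\<forall>m. 1 \<le> m \<longrightarrow> m \<le> n \<longrightarrow> m dvd M)"
proof -
  define S where "S = {p::nat. prime p \<and> p \<le> n}"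
  define e where "e p = (GREATEST k. p ^ k \<le> n)" for p :: nat
  define M where "M = (\<Prod>p\<in>S. p ^ e p)"
  have S: "finite S" "\<And>p. p \<in> S \<Longrightarrow> prime p"
    by (auto simp: S_def)
  \<comment> \<open>\<open>GREATEST\<close> is meaningful only for a bounded set of
    exponents.\<close>
  have bound: "k \<le> n" if "prime p" "p ^ k \<le> n" for p k
  proof -
    have "k < 2 ^ k" by simp
    also have "\<dots> \<le> p ^ k" using that by (intro power_mono prime_ge_2_nat) auto
    finally show ?thesis using that by simp
  qed
  have e1: "p ^ e p \<le> n" if "prime p" for p
    unfolding e_def by (rule GreatestI_nat[where b = n and k = 0]) (use assms bound that in auto)
  have e2: "k \<le> e p" if "prime p" "p ^ k \<le> n" for p k
    unfolding e_def by (rule Greatest_le_nat[where b = n]) (use bound that in auto)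
  have "M > 0"
    unfolding M_def using S by (intro prod_pos) (auto simp: prime_gt_0_nat)
  moreover have "M \<le> n ^ card S"
  proof -
    have "M \<le> (\<Prod>p\<in>S. n)"
      unfolding M_def using S e1 by (intro prod_mono) auto
    then show ?thesis by simp
  qed
  moreover have "m dvd M" if "1 \<le> m" "m \<le> n" for m
  proof (rule multiplicity_le_imp_dvd)
    show "m \<noteq> 0" using that by simp
    fix p :: nat assume p: "prime p"
    have le: "p ^ multiplicity p m \<le> n"
      using dvd_imp_le[OF multiplicity_dvd[of p m]] that by simp
    show "multiplicity p m \<le> multiplicity p M"
    proof (cases "p \<in> S")
      case True
      then show ?thesis
        unfolding M_def using multiplicity_prod_prime_powers[OF S p] e2[OF p le] by simp
    next
      case False
      then have "\<not> p dvd m"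
        using that p dvd_imp_le[of p m] by (auto simp: S_def)
      then show ?thesis by (simp add: not_dvd_imp_multiplicity_0)
    qed
  qed
  ultimately show ?thesis unfolding S_def by blast
qed

text \<open>Nair's form of Chebyshev's bound: a common multiple of 1, ..., \<open>2 * m + 1\<close>
  is divisible by \<open>(2 * m + 1) * ((2 * m) choose m)\<close>, which is at least
  \<open>4 ^ m\<close>.\<close>

lemma power4_le_power_card_primes:
  "4 ^ m \<le> (2 * m + 1) ^ card {p::nat. prime p \<and> p \<le> 2 * m + 1}"
proof (cases "m = 0")
  case False
  obtain M where M: "0 < M" "M \<le> (2 * m + 1) ^ card {p. prime p \<and> p \<le> 2 * m + 1}"
    "\<And>k. 1 \<le> k \<Longrightarrow> k \<le> 2 * m + 1 \<Longrightarrow> k dvd M"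
    using ex_common_multiple_le_power_card_primes[of "2 * m + 1"] by auto
  have "Suc (2 * m) * ((2 * m) choose m) dvd M"
    by (rule Suc_times_binomial_dvd_common_multiple) (use M in auto)
  then have le: "Suc (2 * m) * ((2 * m) choose m) \<le> M"
    using M by (intro dvd_imp_le)
  have "4 ^ m / (2 * real m) \<le> real ((2 * m) choose m)"
    using False by (intro central_binomial_lower_bound) auto
  then have "4 ^ m \<le> 2 * real m * real ((2 * m) choose m)"
    using False by (simp add: field_simps)
  then have "real (4 ^ m) \<le> real (2 * m * ((2 * m) choose m))"
    by simp
  then have "4 ^ m \<le> 2 * m * ((2 * m) choose m)"
    by (simp only: of_nat_le_iff)
  also have "\<dots> \<le> Suc (2 * m) * ((2 * m) choose m)"
    by simp
  finally show ?thesis using le M by linarith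
qed simp

text \<open>Fewer than \<open>N\<close> primes would contradict the preceding bound at
  \<open>m = 4 * N^2\<close>, since \<open>8 * N^2 + 1\<close> is below \<open>4 ^ (4 * N)\<close>.
  The quadratic range is generous, but only its logarithm matters later.\<close>

lemma card_primes_ge:
  fixes N :: nat
  assumes "N \<ge> 1"
  shows "N \<le> card {p::nat. prime p \<and> p \<le> 8 * N\<^sup>2 + 1}"
proof (rule ccontr)
  assume "\<not> ?thesis"
  then have card: "card {p::nat. prime p \<and> p \<le> 8 * N\<^sup>2 + 1} \<le> N" by simp
  have "N < 2 ^ N" by simp
  then have "N\<^sup>2 \<le> (2 ^ N)\<^sup>2" by (intro power_mono) auto
  then have "N\<^sup>2 \<le> 4 ^ N" by (simp add: power_mult[symmetric] mult.commute[of N] power_mult)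
  moreover have "(64::nat) ^ 1 \<le> 64 ^ N" using assms by (intro power_increasing) auto
  ultimately have "64 * N\<^sup>2 \<le> 64 ^ N * 4 ^ N" by (intro mult_mono) auto
  then have "64 * N\<^sup>2 \<le> 4 ^ (4 * N)"
    by (simp add: power_mult power_mult_distrib[symmetric])
  moreover have "N\<^sup>2 \<ge> 1" using assms by simp
  ultimately have lt: "8 * N\<^sup>2 + 1 < 4 ^ (4 * N)" by linarith
  have "(4::nat) ^ (4 * N\<^sup>2) \<le> (8 * N\<^sup>2 + 1) ^ card {p::nat. prime p \<and> p \<le> 8 * N\<^sup>2 + 1}"
    using power4_le_power_card_primes[of "4 * N\<^sup>2"] by simp
  also have "\<dots> \<le> (8 * N\<^sup>2 + 1) ^ N"
    using card by (intro power_increasing) auto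
  also have "\<dots> < (4 ^ (4 * N)) ^ N"
    using lt assms by (intro power_strict_mono) auto
  finally show False
    by (simp add: power_mult[symmetric] power2_eq_square mult.assoc)
qed

subsection \<open>Vectors far from primitive ones\<close>

lemma finite_height_le: "finite {h :: int ^ 'n. height h \<le> int H}"
  and card_height_le: "card {h :: int ^ 'n. height h \<le> int H} \<le> (2 * H + 1) ^ CARD('n)"
proof -
  define F where "F = (UNIV :: 'n set) \<rightarrow>\<^sub>E {- int H..int H}"
  have "finite F"
    unfolding F_def by (intro finite_PiE) auto
  have "card F = (2 * H + 1) ^ CARD('n)"
    unfolding F_def by (simp add: card_PiE nat_add_distrib nat_mult_distrib)
  have sub: "{h :: int ^ 'n. height h \<le> int H} \<subseteq> vec_lambda ` F"
  proof
    fix h :: "int ^ 'n" assume h: "h \<in> {h. height h \<le> int H}"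
    have "\<bar>h $ i\<bar> \<le> height h" for i
      unfolding height_def by (intro Max_ge) auto
    then have "\<bar>h $ i\<bar> \<le> int H" for i
      using h order_trans by blast
    then have "vec_nth h \<in> F"
      unfolding F_def by (auto simp: abs_le_iff minus_le_iff)
    then show "h \<in> vec_lambda ` F"
      by (metis image_eqI vec_nth_inverse)
  qed
  show "finite {h :: int ^ 'n. height h \<le> int H}"
    using sub \<open>finite F\<close> finite_surj by blast
  show "card {h :: int ^ 'n. height h \<le> int H} \<le> (2 * H + 1) ^ CARD('n)"
    using surj_card_le[OF \<open>finite F\<close> sub] \<open>card F = _\<close> by simp
qed

text \<open>The all-ones vector has gcd 1, and moving \<open>a\<close> to it changes each coordinate
  by at most \<open>height a + 1\<close>. Hence a large \<open>ell a\<close> forces a large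
  height.\<close>

lemma ell_le_height: "int (ell (a :: int ^ 'n)) \<le> height a + 1"
proof -
  define h :: "int ^ 'n" where "h = (\<chi> i. 1 - a $ i)"
  have "ell a \<le> nat (height h)"
    unfolding ell_def by (rule Least_le) (auto simp: h_def height_nonneg intro!: exI[of _ h])
  moreover have "height h \<le> height a + 1"
  proof -
    have "\<bar>h $ i\<bar> \<le> height a + 1" for i
    proof -
      have "\<bar>a $ i\<bar> \<le> height a"
        unfolding height_def by (intro Max_ge) auto
      then show ?thesis by (simp add: h_def)
    qed
    then show ?thesis
      unfolding height_def[of h] by (subst Max_le_iff) auto
  qed
  ultimately show ?thesis using height_nonneg[of h] by linarith
qed

lemma ex_ell_gt_height_less:
  fixes H :: nat
  defines "N \<equiv> (2 * H + 1) ^ CARD('n)"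
  shows "\<exists>a :: int ^ 'n. H < ell a \<and> height a < int ((9 * N\<^sup>2) ^ N)"
proof -
  define B where "B = {h :: int ^ 'n. height h \<le> int H}"
  define S where "S = {p::nat. prime p \<and> p \<le> 8 * N\<^sup>2 + 1}"
  have "N \<ge> 1" by (simp add: N_def)
  have B: "finite B" "card B \<le> N"
    using finite_height_le card_height_le unfolding B_def N_def by blast+
  moreover have "finite S" "N \<le> card S"
    using card_primes_ge[OF \<open>N \<ge> 1\<close>] by (auto simp: S_def)
  ultimately obtain p where p: "p ` B \<subseteq> S" "inj_on p B"
    using card_le_inj[of B S] by force
  have prime: "prime (p h)" and p_le: "p h \<le> 9 * N\<^sup>2" if "h \<in> B" for h
  proof -
    show "prime (p h)" using p that by (auto simp: S_def)
    have "N\<^sup>2 \<ge> 1" using \<open>N \<ge> 1\<close> by simp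
    moreover have "p h \<le> 8 * N\<^sup>2 + 1" using p that by (auto simp: S_def)
    ultimately show "p h \<le> 9 * N\<^sup>2" by linarith
  qed
  \<comment> \<open>The remainder theorem is applied over the naturals, one coordinate at a time, so
    \<open>- (h $ i)\<close> is replaced by its least nonnegative residue.\<close>
  have "\<exists>x. x < (\<Prod>h\<in>B. p h) \<and> (\<forall>h\<in>B. [x = nat ((- (h $ i)) mod int (p h))] (mod p h))" for i
  proof -
    have "\<forall>h\<in>B. p h \<noteq> 0" using prime by (metis not_prime_0)
    moreover have "\<forall>h\<in>B. \<forall>k\<in>B. h \<noteq> k \<longrightarrow> coprime (p h) (p k)"
      using prime p(2) by (metis primes_coprime inj_onD)
    ultimately show ?thesis
      by (rule ex1_implies_ex[OF chinese_remainder_unique_nat[OF B(1)]])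
  qed
  then obtain x where x_less: "\<And>i. x i < (\<Prod>h\<in>B. p h)"
    and x_cong: "\<And>i h. h \<in> B \<Longrightarrow> [x i = nat ((- (h $ i)) mod int (p h))] (mod p h)"
    by metis
  define a :: "int ^ 'n" where "a = (\<chi> i. int (x i))"
  have "H < ell a"
  proof (rule ccontr)
    assume "\<not> H < ell a"
    \<comment> \<open>A minimizer of height at most \<open>H\<close> lies in \<open>B\<close>, so
      its own prime divides a gcd equal to 1.\<close>
    obtain h :: "int ^ 'n" where h: "height h = int (ell a)" "Gcd (range (\<lambda>i. a $ i + h $ i)) = 1"
      using ell_attained by blast
    then have "h \<in> B" using \<open>\<not> H < ell a\<close> by (simp add: B_def)
    have "int (p h) dvd a $ i + h $ i" for i
    proof -
      have "p h > 0" using prime[OF \<open>h \<in> B\<close>] by (rule prime_gt_0_nat)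
      then have "[int (x i) = (- (h $ i)) mod int (p h)] (mod int (p h))"
        using x_cong[OF \<open>h \<in> B\<close>, of i] unfolding cong_int_iff[symmetric] by simp
      then have "[int (x i) = - (h $ i)] (mod int (p h))"
        by (simp add: cong_def)
      then show ?thesis
        by (simp add: a_def cong_iff_dvd_diff)
    qed
    then have "int (p h) dvd Gcd (range (\<lambda>i. a $ i + h $ i))"
      by (intro Gcd_greatest) auto
    then show False
      using h prime[OF \<open>h \<in> B\<close>] by (simp add: zdvd1_eq)
  qed
  moreover have "height a < int ((9 * N\<^sup>2) ^ N)"
  proof -
    have "(\<Prod>h\<in>B. p h) \<le> (\<Prod>h\<in>B. 9 * N\<^sup>2)"
      using p_le by (intro prod_mono) auto
    also have "\<dots> = (9 * N\<^sup>2) ^ card B" by simp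
    also have "\<dots> \<le> (9 * N\<^sup>2) ^ N"
      using B \<open>N \<ge> 1\<close> by (intro power_increasing) auto
    finally have "int (x i) < int ((9 * N\<^sup>2) ^ N)" for i
      using x_less[of i] by linarith
    then show ?thesis
      unfolding height_def by (subst Max_less_iff) (auto simp: a_def simp del: of_nat_power of_nat_mult)
  qed
  ultimately show ?thesis by blast
qed

section \<open>Logarithmic estimates and the infinite family\<close>

text \<open>Comparing \<open>ln x\<close> with \<open>N\<close> avoids any monotonicity of t / ln t.
  If \<open>ln x\<close> is at most \<open>N\<close>, it suffices that \<open>ln (ln x)\<close> is
  at least 1, which 27 = 3^3 guarantees. Otherwise \<open>ln (ln x)\<close> exceeds
  \<open>ln N\<close>, while \<open>ln x\<close> is at most \<open>4 * N * ln N\<close>.\<close>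

lemma ln_div_ln_ln_le:
  fixes x :: real and N :: nat
  assumes "27 \<le> x" "x \<le> real ((9 * N\<^sup>2) ^ N)" "N \<ge> 3"
  shows "0 \<le> ln x / ln (ln x)" and "ln x / ln (ln x) \<le> 4 * real N"
proof -
  have ln3: "1 \<le> ln (3::real)"
    using exp_le by (subst ln_ge_iff) auto
  have "3 \<le> ln (27::real)"
    using ln3 ln_realpow[of 3 3] by simp
  also have "\<dots> \<le> ln x" using assms by simp
  finally have "3 \<le> ln x" .
  then have "ln 3 \<le> ln (ln x)" by simp
  then have ll: "1 \<le> ln (ln x)" using ln3 by linarith
  then show "0 \<le> ln x / ln (ln x)" using \<open>3 \<le> ln x\<close> by simp
  show "ln x / ln (ln x) \<le> 4 * real N"
  proof (cases "ln x \<le> real N")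
    case True
    have "ln x * 1 \<le> (4 * real N) * ln (ln x)"
      using True ll by (intro mult_mono) auto
    then show ?thesis using ll by (simp add: divide_simps)
  next
    case False
    have "ln x \<le> ln (real ((9 * N\<^sup>2) ^ N))"
      using assms by (subst ln_le_cancel_iff) auto
    also have "real ((9 * N\<^sup>2) ^ N) = (9 * (real N)\<^sup>2) ^ N"
      by simp
    also have "ln \<dots> = real N * ln (9 * (real N)\<^sup>2)"
      by (rule ln_realpow)
    also have "ln (9 * (real N)\<^sup>2) = 2 * ln 3 + 2 * ln (real N)"
      using assms ln_realpow[of 3 2] by (simp add: ln_mult ln_realpow)
    also have "real N * \<dots> \<le> real N * (4 * ln (real N))"
      using assms by (intro mult_left_mono) auto
    also have "\<dots> \<le> real N * (4 * ln (ln x))"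
      using False assms by (intro mult_left_mono) auto
    finally show ?thesis using ll by (simp add: divide_simps mult_ac)
  qed
qed

lemma ex_ell_gt_bound:
  fixes H :: nat
  assumes "H \<ge> 27"
  shows "\<exists>a :: int ^ 'n. H < ell a \<and> height a \<ge> 3 \<and>
    \<bar>(ln (real_of_int (height a)) / ln (ln (real_of_int (height a)))) powr (1 / real CARD('n))\<bar>
      \<le> 12 * real (ell a)"
proof -
  define n where "n = CARD('n)"
  define N where "N = (2 * H + 1) ^ n"
  have "n \<ge> 1" by (simp add: n_def Suc_le_eq)
  obtain a :: "int ^ 'n" where a: "H < ell a" "height a < int ((9 * N\<^sup>2) ^ N)"
    using ex_ell_gt_height_less[where 'n = 'n, of H] unfolding N_def n_def by blast
  define q where "q = ln (real_of_int (height a)) / ln (ln (real_of_int (height a)))"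
  \<comment> \<open>Here \<open>ell a\<close> is at least 28, and the height is at least
    \<open>ell a - 1\<close>.\<close>
  have height: "27 \<le> height a"
    using ell_le_height[of a] a assms by linarith
  have "(2 * H + 1) ^ 1 \<le> N"
    unfolding N_def using \<open>n \<ge> 1\<close> by (intro power_increasing) auto
  then have "N \<ge> 3" using assms by simp
  have le: "real_of_int (height a) \<le> real ((9 * N\<^sup>2) ^ N)"
    using a(2) by linarith
  have q: "0 \<le> q" "q \<le> 4 * real N"
    unfolding q_def using ln_div_ln_ln_le[OF _ le \<open>N \<ge> 3\<close>] height by auto
  \<comment> \<open>Enlarging 4 to \<open>4 ^ n\<close> turns the bound for \<open>q\<close> into an
    exact \<open>n\<close>-th power. Its root \<open>8 * H + 4\<close> is below
    \<open>12 * ell a\<close>, so the constant 12 serves every dimension.\<close>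
  have "4 ^ 1 \<le> (4::real) ^ n" using \<open>n \<ge> 1\<close> by (intro power_increasing) auto
  then have "4 * real N \<le> 4 ^ n * real N" by (intro mult_right_mono) auto
  also have "\<dots> = (4 * (2 * real H + 1)) ^ n"
    by (subst power_mult_distrib) (simp add: N_def add.commute)
  finally have "q \<le> (4 * (2 * real H + 1)) powr real n"
    using q by (simp add: powr_realpow)
  then have "q powr (1 / real n) \<le> ((4 * (2 * real H + 1)) powr real n) powr (1 / real n)"
    using q by (intro powr_mono2) auto
  also have "\<dots> = 4 * (2 * real H + 1)"
    using \<open>n \<ge> 1\<close> by (simp add: powr_powr)
  also have "\<dots> \<le> 12 * real (ell a)"
    using a(1) by simp
  finally have "\<bar>q powr (1 / real n)\<bar> \<le> 12 * real (ell a)"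
    by simp
  then show ?thesis
    using a height unfolding q_def n_def by (intro exI[of _ a]) auto
qed

theorem theorem3:
  "\<exists>c::real. c > 0 \<and>
    infinite {a :: int ^ 'n. height a \<ge> 3 \<and>
      \<bar>(ln (real_of_int (height a)) / ln (ln (real_of_int (height a)))) powr (1 / real CARD('n))\<bar>
        \<le> c * real (ell a)}"
proof (intro exI[of _ 12] conjI)
  let ?A = "{a :: int ^ 'n. height a \<ge> 3 \<and>
      \<bar>(ln (real_of_int (height a)) / ln (ln (real_of_int (height a)))) powr (1 / real CARD('n))\<bar>
        \<le> 12 * real (ell a)}"
  \<comment> \<open>Distinctness of the vectors comes from \<open>ell\<close> being unbounded on the
    set; the maximum with 27 meets the hypothesis on \<open>H\<close>.\<close>
  have "\<exists>m\<in>ell ` ?A. H < m" for H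
    using ex_ell_gt_bound[where 'n = 'n, of "max 27 H"] by fastforce
  then have "infinite (ell ` ?A)"
    unfolding infinite_nat_iff_unbounded by blast
  then show "infinite ?A" by blast
qed simp

end
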